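(* In the multistage inventory setting described in the context, with $c_{T+1}:=0$, suppose that for all $t=1,\dots,T$: $b'_t:=b_t-c_t+\rho c_{t+1}>0$, $h'_t:=h_t+c_t-\rho c_{t+1}>0$, $\sigma_t>0$, $\mu_t>0$, $\mathcal I_t=\mathbb R_+$, and $$\frac{\sigma_t^2}{\mu_t^2}>\frac{b'_t}{h'_t}.$$ Suppose also that $y_1=0$. Then the set of optimal policies for the multistage-static problem is exactly the set $\Pi^0$ of all policies $\pi=(x_1,\dots,x_T)\in\Pi$ such that $x_1=0$ and, for every $t\in\{1,\dots,T\}$, the order-up-to level $x_t$ equals $0$ whenever the inventory level $y_t$ at the start of stage $t$ satisfies $y_t\le 0$ (that is, $x_t(d_{[t-1]})=0$ for all $d_{[t-1]}\in\mathbb R_+^{t-1}$ with $y_t^\pi(d_{[t-1]})\le0$). Moreover, the multistage-static problem is strongly time consistent.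
   Context: Setting. $T\ge1$ is a finite horizon, $\rho\in(0,1]$ a discount factor, $y_1\in\mathbb R$ a given initial inventory level. For $t=1,\dots,T$: $c_t,b_t,h_t$ are ordering, backorder and holding costs with $b_t>c_t>0$, $h_t\ge0$; $\mathcal I_t$ is a closed interval; $\mu_t$ and $\sigma_t^2$ are a mean and a variance; $\mathcal M_t$ is the (nonempty) set of probability measures $Q_t$ on $\mathbb R$ with support in $\mathcal I_t$, $\mathbb E_{Q_t}[D_t]=\mu_t$, $\mathbb E_{Q_t}[D_t^2]=\mu_t^2+\sigma_t^2$. Let $\mathcal M=\{Q_1\times\cdots\times Q_T: Q_t\in\mathcal M_t,\ t=1,\dots,T\}$ (product measures for the demand vector $(D_1,\dots,D_T)$). Write $d_{[t]}=(d_1,\dots,d_t)$ and $[a]_+=\max\{a,0\}$. Policies. $\Pi$ is the set of admissible policies $\pi=(x_1,\dots,x_T)$ of measurable functions $x_t=x_t^\pi:\mathbb R_+^{t-1}\to\mathbb R$ ($x_1$ a constant) with $x_t(d_{[t-1]})\ge y_t$ for all $d_{[t-1]}\in\mathbb R_+^{t-1}$ and all $t$, where $y_{t+1}=y_{t+1}^\pi(d_{[t]})=x_t(d_{[t-1]})-d_t$. Costs. $\Psi_t(x,d)=b_t[d-x]_++h_t[x-d]_+$ and $$Z^\pi(D_{[T]})=\sum_{t=1}^T\rho^{t-1}\big[c_t(x_t^\pi(D_{[t-1]})-y_t^\pi(D_{[t-1]}))+\Psi_t(x_t^\pi(D_{[t-1]}),D_t)\big].$$ Multistage-static problem: $\inf_{\pi\in\Pi}\sup_{Q\in\mathcal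 M}\mathbb E_Q[Z^\pi]$; $\pi$ is optimal if it attains the infimum. Distributionally robust DP formulation: $V_{T+1}\equiv0$, $$V_t(y)=\inf_{x\ge y}\Big\{c_t(x-y)+\sup_{Q_t\in\mathcal M_t}\mathbb E_{Q_t}[\Psi_t(x,D_t)+\rho V_{t+1}(x-D_t)]\Big\},$$ and $\mathcal Y_t(y)$ is the set of minimizers $x\ge y$ in this problem. A policy $\pi\in\Pi$ is robust-w.p.1-optimal for the DP formulation if for every $Q\in\mathcal M$, with probability one under $Q$, $x_t^\pi(D_{[t-1]})\in\mathcal Y_t(y_t^\pi(D_{[t-1]}))$ for all $t=1,\dots,T$. Time consistency. A policy is time consistent if it is optimal for the multistage-static problem and robust-w.p.1-optimal for the DP formulation. The multistage-static problem is strongly time consistent if every one of its optimal policies is time consistent. *)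

theory Defs
  imports "HOL-Probability.Probability"
begin

record inventory =
  horizon :: nat
  discount :: real
  init_level :: real
  order_cost :: "nat \<Rightarrow> real"
  backorder_cost :: "nat \<Rightarrow> real"
  holding_cost :: "nat \<Rightarrow> real"
  demand_range :: "nat \<Rightarrow> real set"
  demand_mean :: "nat \<Rightarrow> real"
  demand_sd :: "nat \<Rightarrow> real"

text \<open>
  For a closed set, having support in it is the same as giving it full measure. The integrability
  conditions are needed because the integral of a non-integrable function is \<open>0\<close> by convention.
\<close>

definition marginals :: "inventory \<Rightarrow> nat \<Rightarrow> real measure set" where
  "marginals P t = {Q. prob_space Q \<and> sets Q = sets borel \<and> (AE d in Q. d \<in> demand_range P t) \<and>
     integrable Q (\<lambda>d. d) \<and> (\<integral>d. d \<partial>Q) = demand_mean P t \<and>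
     integrable Q (\<lambda>d. d\<^sup>2) \<and> (\<integral>d. d\<^sup>2 \<partial>Q) = (demand_mean P t)\<^sup>2 + (demand_sd P t)\<^sup>2}"

definition ambiguity_set :: "inventory \<Rightarrow> (nat \<Rightarrow> real) measure set" where
  "ambiguity_set P =
     {Pi\<^sub>M {1..horizon P} Q | Q. \<forall>t\<in>{1..horizon P}. Q t \<in> marginals P t}"

definition inventory_model :: "inventory \<Rightarrow> bool" where
  "inventory_model P \<longleftrightarrow>
     1 \<le> horizon P \<and> 0 < discount P \<and> discount P \<le> 1 \<and>
     (\<forall>t\<in>{1..horizon P}.
        0 < order_cost P t \<and> order_cost P t < backorder_cost P t \<and> 0 \<le> holding_cost P t \<and>
        closed (demand_range P t) \<and> is_interval (demand_range P t) \<and> marginals P t \<noteq> {})"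

text \<open>
  Demands are indexed from 1. The history \<open>(d\<^sub>1, \<dots>, d\<^bsub>t-1\<^esub>)\<close> known when the stage \<open>t\<close> order is
  placed is an extensional function on \<open>{1..<t}\<close>; for \<open>t = 1\<close> there is exactly one history.
\<close>

definition history :: "nat \<Rightarrow> (nat \<Rightarrow> real) \<Rightarrow> nat \<Rightarrow> real" where
  "history t d = restrict d {1..<t}"

definition histories :: "nat \<Rightarrow> (nat \<Rightarrow> real) set" where
  "histories t = {1..<t} \<rightarrow>\<^sub>E {0..}"

type_synonym policy = "nat \<Rightarrow> (nat \<Rightarrow> real) \<Rightarrow> real"

definition level :: "inventory \<Rightarrow> policy \<Rightarrow> nat \<Rightarrow> (nat \<Rightarrow> real) \<Rightarrow> real" where
  "level P x t d =
     (if t = 1 then init_level P else x (t - 1) (history (t - 1) d) - d (t - 1))"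

text \<open>
  Only the values \<open>x t d\<close> with \<open>t \<in> {1..horizon P}\<close> and \<open>d \<in> histories t\<close> are meaningful; nothing
  is required of the others, and every notion below is insensitive to them when the demand
  ranges are contained in \<open>{0..}\<close>.
\<close>

definition policies :: "inventory \<Rightarrow> policy set" where
  "policies P = {x. \<forall>t\<in>{1..horizon P}.
     x t \<in> borel_measurable (Pi\<^sub>M {1..<t} (\<lambda>_. restrict_space borel {0..})) \<and>
     (\<forall>d\<in>histories t. level P x t d \<le> x t d)}"

definition stage_cost :: "inventory \<Rightarrow> nat \<Rightarrow> real \<Rightarrow> real \<Rightarrow> real" where
  "stage_cost P t x d =
     backorder_cost P t * max (d - x) 0 + holding_cost P t * max (x - d) 0"

definition total_cost :: "inventory \<Rightarrow> policy \<Rightarrow> (nat \<Rightarrow> real) \<Rightarrow> real" where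
  "total_cost P x d = (\<Sum>t=1..horizon P. discount P ^ (t - 1) *
     (order_cost P t * (x t (history t d) - level P x t d) + stage_cost P t (x t (history t d)) (d t)))"

text \<open>
  All costs of an admissible policy are nonnegative along nonnegative demands, so their
  expectations are taken in \<open>[0, \<infinity>]\<close>.
\<close>

definition worst_case_cost :: "inventory \<Rightarrow> policy \<Rightarrow> ennreal" where
  "worst_case_cost P x = (SUP Q\<in>ambiguity_set P. \<integral>\<^sup>+ d. ennreal (total_cost P x d) \<partial>Q)"

definition optimal_policies :: "inventory \<Rightarrow> policy set" where
  "optimal_policies P =
     {x \<in> policies P. worst_case_cost P x = (INF x'\<in>policies P. worst_case_cost P x')}"

definition dp_objective ::
    "inventory \<Rightarrow> nat \<Rightarrow> (real \<Rightarrow> ennreal) \<Rightarrow> real \<Rightarrow> real \<Rightarrow> ennreal" where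
  "dp_objective P t W y x = ennreal (order_cost P t * (x - y)) +
     (SUP Q\<in>marginals P t.
        \<integral>\<^sup>+ d. ennreal (stage_cost P t x d) + ennreal (discount P) * W (x - d) \<partial>Q)"

function dp_value :: "inventory \<Rightarrow> nat \<Rightarrow> real \<Rightarrow> ennreal" where
  "dp_value P t y =
     (if horizon P < t then 0
      else (INF x\<in>{y..}. dp_objective P t (\<lambda>z. dp_value P (Suc t) z) y x))"
  by auto
termination
  by (relation "Wellfounded.measure (\<lambda>(P, t, y). Suc (horizon P) - t)") auto

declare dp_value.simps [simp del]

definition dp_minimizers :: "inventory \<Rightarrow> nat \<Rightarrow> real \<Rightarrow> real set" where
  "dp_minimizers P t y =
     {x \<in> {y..}. \<forall>x'\<in>{y..}.
        dp_objective P t (dp_value P (Suc t)) y x \<le> dp_objective P t (dp_value P (Suc t)) y x'}"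

definition robust_wp1_optimal :: "inventory \<Rightarrow> policy \<Rightarrow> bool" where
  "robust_wp1_optimal P x \<longleftrightarrow> x \<in> policies P \<and>
     (\<forall>Q\<in>ambiguity_set P. AE d in Q. \<forall>t\<in>{1..horizon P}.
        x t (history t d) \<in> dp_minimizers P t (level P x t d))"

definition time_consistent :: "inventory \<Rightarrow> policy \<Rightarrow> bool" where
  "time_consistent P x \<longleftrightarrow> x \<in> optimal_policies P \<and> robust_wp1_optimal P x"

definition strongly_time_consistent :: "inventory \<Rightarrow> bool" where
  "strongly_time_consistent P \<longleftrightarrow> (\<forall>x\<in>optimal_policies P. time_consistent P x)"

text \<open>The ordering cost of the next stage, which is \<open>0\<close> after the horizon.\<close>

definition next_order_cost :: "inventory \<Rightarrow> nat \<Rightarrow> real" where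
  "next_order_cost P t = (if t < horizon P then order_cost P (Suc t) else 0)"

definition net_backorder_cost :: "inventory \<Rightarrow> nat \<Rightarrow> real" where
  "net_backorder_cost P t =
     backorder_cost P t - order_cost P t + discount P * next_order_cost P t"

definition net_holding_cost :: "inventory \<Rightarrow> nat \<Rightarrow> real" where
  "net_holding_cost P t =
     holding_cost P t + order_cost P t - discount P * next_order_cost P t"

definition zero_policies :: "inventory \<Rightarrow> policy set" where
  "zero_policies P = {x \<in> policies P.
     (\<forall>d\<in>histories 1. x 1 d = 0) \<and>
     (\<forall>t\<in>{1..horizon P}. \<forall>d\<in>histories t. level P x t d \<le> 0 \<longrightarrow> x t d = 0)}"

end

theory Submission
  imports Defs
begin

text \<open>
  Charging the saving on future orders to the stage that leaves stock over splits the total cost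
  into newsvendor costs with unit costs \<open>b'\<^sub>t\<close> and \<open>h'\<^sub>t\<close>, plus terms that do not depend on the
  policy. At order-up-to level \<open>0\<close> the cost of stage \<open>t\<close> has expectation \<open>b'\<^sub>t \<mu>\<^sub>t\<close> under every
  marginal. Under the two-point law on \<open>0\<close> and \<open>(\<mu>\<^sub>t\<^sup>2 + \<sigma>\<^sub>t\<^sup>2) / \<mu>\<^sub>t\<close> every other level is strictly
  worse, by the hypothesis on \<open>\<sigma>\<^sub>t\<^sup>2 / \<mu>\<^sub>t\<^sup>2\<close>. As every point of \<open>[0, \<infinity>)\<close> is an atom of some
  marginal, an optimal policy must order up to \<open>0\<close> after every history; then the inventory never
  becomes positive, so these are exactly the policies in \<open>\<Pi>\<^sup>0\<close>. The same bounds, propagated backwards,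
  show that the value functions dominate affine functions and agree with them on \<open>y \<le> 0\<close>, whence
  \<open>0\<close> is a minimizer of the dynamic programme there.
\<close>

subsection \<open>Finitely supported demand distributions\<close>

text \<open>The weights sit on indices, not on points, so points may coincide and their masses then
  add up; this happens in \<open>ex_marginal_atom\<close> when \<open>d\<close> is 0 or equals the
  third point.\<close>

definition finite_law :: "real list \<Rightarrow> real list \<Rightarrow> real measure" where
  "finite_law ws ds =
     distr (point_measure {..<length ds} (\<lambda>i. ennreal (ws ! i))) borel (\<lambda>i. ds ! i)"

lemma sets_finite_law [simp, measurable_cong]: "sets (finite_law ws ds) = sets borel"
  by (simp add: finite_law_def)

lemma nn_integral_finite_law:
  assumes "f \<in> borel_measurable borel"
  shows "(\<integral>\<^sup>+ d. f d \<partial>finite_law ws ds) = (\<Sum>i<length ds. ennreal (ws ! i) * f (ds ! i))"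
  using assms unfolding finite_law_def
  by (subst nn_integral_distr) (auto simp: nn_integral_point_measure_finite)

lemma
  fixes f :: "real \<Rightarrow> real"
  assumes "f \<in> borel_measurable borel"
  shows integrable_finite_law: "integrable (finite_law ws ds) f"
    and integral_finite_law: "(\<And>i. i < length ds \<Longrightarrow> 0 \<le> ws ! i) \<Longrightarrow>
      (\<integral>d. f d \<partial>finite_law ws ds) = (\<Sum>i<length ds. ws ! i * f (ds ! i))"
proof -
  show "integrable (finite_law ws ds) f"
    using assms unfolding finite_law_def
    by (simp add: integrable_distr_eq integrable_point_measure_finite)
  show "(\<integral>d. f d \<partial>finite_law ws ds) = (\<Sum>i<length ds. ws ! i * f (ds ! i))"
    if "\<And>i. i < length ds \<Longrightarrow> 0 \<le> ws ! i"
    using assms that unfolding finite_law_def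
    by (subst integral_distr) (simp_all, subst lebesgue_integral_point_measure_finite, auto)
qed

lemma finite_law_mem_marginals:
  assumes "\<And>i. i < length ds \<Longrightarrow> 0 \<le> ws ! i" and "\<And>i. i < length ds \<Longrightarrow> 0 \<le> ds ! i"
    and "demand_range P t = {0..}"
    and "(\<Sum>i<length ds. ws ! i) = 1"
    and "(\<Sum>i<length ds. ws ! i * ds ! i) = demand_mean P t"
    and "(\<Sum>i<length ds. ws ! i * (ds ! i)\<^sup>2) = (demand_mean P t)\<^sup>2 + (demand_sd P t)\<^sup>2"
  shows "finite_law ws ds \<in> marginals P t"
proof -
  have *: "(\<Sum>i<length ds. ennreal (ws ! i)) = ennreal (\<Sum>i<length ds. ws ! i)"
    using assms(1) by (intro sum_ennreal) auto
  have "prob_space (finite_law ws ds)"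
    unfolding finite_law_def
  proof (rule prob_space.prob_space_distr)
    show "prob_space (point_measure {..<length ds} (\<lambda>i. ennreal (ws ! i)))"
      using assms * by (intro prob_space_point_measure) auto
  qed auto
  moreover have "AE d in finite_law ws ds. d \<in> {0..}"
    unfolding finite_law_def using assms(2)
    by (subst AE_distr_iff) (auto simp: AE_point_measure)
  ultimately show ?thesis
    using assms by (simp add: marginals_def integrable_finite_law integral_finite_law)
qed

text \<open>Only an inequality, because the point may occur in the list again.\<close>

lemma emeasure_finite_law_ge:
  assumes "i < length ds"
  shows "ennreal (ws ! i) \<le> emeasure (finite_law ws ds) {ds ! i}"
proof -
  have "ennreal (ws ! i) = ennreal (ws ! i) * indicator {ds ! i} (ds ! i)"
    by simp
  also have "\<dots> \<le> (\<Sum>j<length ds. ennreal (ws ! j) * indicator {ds ! i} (ds ! j))"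
    using assms by (intro member_le_sum) auto
  also have "\<dots> = emeasure (finite_law ws ds) {ds ! i}"
    by (subst nn_integral_finite_law[symmetric]) (auto simp: finite_law_def)
  finally show ?thesis .
qed

text \<open>Put a small mass \<open>e\<close> on \<open>d\<close>. The remaining mass
  \<open>1 - e\<close> must carry first moment \<open>m\<close> and second moment \<open>v\<close>,
  which two points, one of them 0, achieve when \<open>0 < m\<close> and
  \<open>m\<^sup>2 < v * (1 - e)\<close>. At \<open>e = 0\<close> both inequalities are strict, the
  second because the variance is positive, so by continuity they hold for small
  \<open>e\<close>.\<close>

lemma ex_marginal_atom:
  assumes "demand_range P t = {0..}" "0 < demand_mean P t" "0 < demand_sd P t" "0 \<le> d"
  shows "\<exists>Q\<in>marginals P t. emeasure Q {d} > 0"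
proof -
  define \<mu> s where "\<mu> = demand_mean P t" and "s = (demand_mean P t)\<^sup>2 + (demand_sd P t)\<^sup>2"
  have pos: "\<mu> > 0" "s > \<mu>\<^sup>2"
    using assms by (auto simp: \<mu>_def s_def)
  have "((\<lambda>e. \<mu> - e * d) \<longlongrightarrow> \<mu> - 0 * d) (at_right 0)"
    and "((\<lambda>e. (s - e * d\<^sup>2) * (1 - e) - (\<mu> - e * d)\<^sup>2) \<longlongrightarrow>
           (s - 0 * d\<^sup>2) * (1 - 0) - (\<mu> - 0 * d)\<^sup>2) (at_right 0)"
    by (intro tendsto_intros)+
  from this[THEN order_tendstoD(1), of 0]
  have "\<forall>\<^sub>F e in at_right 0. 0 < \<mu> - e * d"
    and "\<forall>\<^sub>F e in at_right 0. 0 < (s - e * d\<^sup>2) * (1 - e) - (\<mu> - e * d)\<^sup>2"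
    using pos by simp_all
  moreover have "\<forall>\<^sub>F e in at_right (0::real). e < 1" "\<forall>\<^sub>F e in at_right (0::real). 0 < e"
    by (auto simp: eventually_at_right_field intro: exI[of _ 1])
  ultimately have "\<forall>\<^sub>F e in at_right 0. 0 < e \<and> e < 1 \<and> 0 < \<mu> - e * d \<and>
      (\<mu> - e * d)\<^sup>2 < (s - e * d\<^sup>2) * (1 - e)"
    by eventually_elim auto
  then obtain e where e: "0 < e" "e < 1" "0 < \<mu> - e * d"
      "(\<mu> - e * d)\<^sup>2 < (s - e * d\<^sup>2) * (1 - e)"
    using eventually_happens[of _ "at_right (0::real)"] by auto
  define m v where "m = \<mu> - e * d" and "v = s - e * d\<^sup>2"
  have mv: "0 < m" "m\<^sup>2 < v * (1 - e)"
    using e by (auto simp: m_def v_def)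
  hence v: "0 < v"
    using e by (smt (verit) mult_nonpos_nonneg zero_le_power2)
  \<comment> \<open>The weights and the third point are the solution of the three moment equations.\<close>
  define Q where "Q = finite_law [1 - e - m\<^sup>2 / v, e, m\<^sup>2 / v] [0, d, v / m]"
  have "Q \<in> marginals P t"
    unfolding Q_def
  proof (rule finite_law_mem_marginals)
    fix i assume i: "i < length [0, d, v / m]"
    hence "i = 0 \<or> i = 1 \<or> i = 2" by auto
    thus "0 \<le> [1 - e - m\<^sup>2 / v, e, m\<^sup>2 / v] ! i" "0 \<le> [0, d, v / m] ! i"
      using mv v e assms(4) by (auto simp: field_simps)
  qed (use assms(1) mv v in \<open>auto simp: numeral_3_eq_3 lessThan_Suc field_simps power2_eq_square
         m_def[symmetric] v_def[symmetric]\<close>, auto simp: m_def v_def \<mu>_def s_def field_simps power2_eq_square)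
  moreover have "ennreal e \<le> emeasure Q {d}"
    unfolding Q_def using emeasure_finite_law_ge[of 1 "[0, d, v / m]" "[1 - e - m\<^sup>2 / v, e, m\<^sup>2 / v]"] by simp
  ultimately show ?thesis
    using e(1) by (intro bexI[of _ Q]) (auto intro: less_le_trans[of 0 "ennreal e"])
qed


text \<open>Truncation at 0 is subadditive. This lets lower bounds with possibly negative affine
  terms pass to \<open>ennreal\<close> without sign conditions.\<close>

lemma ennreal_add_ge: "ennreal (a + b) \<le> ennreal a + ennreal b"
  by (cases "0 \<le> a"; cases "0 \<le> b")
    (auto simp: ennreal_plus[symmetric] ennreal_neg simp del: ennreal_plus intro: ennreal_leI)

subsection \<open>Expected costs under independent demands\<close>

text \<open>The integrand depends on coordinates up to \<open>t\<close> only: project the product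
  onto \<open>{1..t}\<close>, then split off coordinate \<open>t\<close> by Tonelli.\<close>

lemma nn_integral_history:
  fixes Q :: "nat \<Rightarrow> real measure" and F :: "(nat \<Rightarrow> real) \<Rightarrow> real \<Rightarrow> ennreal"
  assumes prob: "\<And>s. prob_space (Q s)" and sets: "\<And>s. sets (Q s) = sets borel"
    and F: "case_prod F \<in> borel_measurable (Pi\<^sub>M {1..<t} (\<lambda>_. borel) \<Otimes>\<^sub>M borel)"
    and t: "t \<in> {1..T}"
  shows "(\<integral>\<^sup>+ d. F (history t d) (d t) \<partial>Pi\<^sub>M {1..T} Q) =
    (\<integral>\<^sup>+ h. \<integral>\<^sup>+ z. F h z \<partial>Q t \<partial>Pi\<^sub>M {1..<t} Q)"
proof -
  interpret prob_space "Q s" for s by (rule prob)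
  interpret product_prob_space Q "{1..T}" ..
  note [measurable] = F
  note [measurable_cong] = sets
  have [measurable_cong]: "sets (Pi\<^sub>M I Q) = sets (Pi\<^sub>M I (\<lambda>_. borel))" for I :: "nat set"
    by (intro sets_PiM_cong) (auto simp: sets)
  define f where "f = (\<lambda>d. F (restrict d {1..<t}) (d t))"
  have "(\<lambda>d. restrict d {1..<t}) \<in> measurable (Pi\<^sub>M {1..t} Q) (Pi\<^sub>M {1..<t} (\<lambda>_. borel))"
    by (intro measurable_restrict) measurable
  moreover have "(\<lambda>d. d t) \<in> borel_measurable (Pi\<^sub>M {1..t} Q)"
    using measurable_component_singleton[of t "{1..t}" Q] t
    by (simp add: measurable_cong_sets[OF refl sets])
  ultimately have "(\<lambda>d. (restrict d {1..<t}, d t)) \<in>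
      measurable (Pi\<^sub>M {1..t} Q) (Pi\<^sub>M {1..<t} (\<lambda>_. borel) \<Otimes>\<^sub>M borel)"
    by (rule measurable_Pair)
  from measurable_compose[OF this F] have f: "f \<in> borel_measurable (Pi\<^sub>M {1..t} Q)"
    by (simp add: f_def)
  have "(\<integral>\<^sup>+ d. F (history t d) (d t) \<partial>Pi\<^sub>M {1..T} Q) =
      (\<integral>\<^sup>+ d. f (restrict d {1..t}) \<partial>Pi\<^sub>M {1..T} Q)"
    using t by (intro nn_integral_cong) (auto simp: f_def history_def Int_absorb1 intro!: arg_cong2[where f = F])
  also have "\<dots> = integral\<^sup>N (distr (Pi\<^sub>M {1..T} Q) (Pi\<^sub>M {1..t} Q) (\<lambda>d. restrict d {1..t})) f"
    using f t by (subst nn_integral_distr) (auto intro!: measurable_restrict_subset)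
  also have "distr (Pi\<^sub>M {1..T} Q) (Pi\<^sub>M {1..t} Q) (\<lambda>d. restrict d {1..t}) = Pi\<^sub>M {1..t} Q"
    using t by (intro distr_PiM_restrict_finite) auto
  also have "{1..t} = insert t {1..<t}"
    using t by auto
  also have "integral\<^sup>N (Pi\<^sub>M (insert t {1..<t}) Q) f =
      (\<integral>\<^sup>+ h. \<integral>\<^sup>+ z. f (h(t := z)) \<partial>Q t \<partial>Pi\<^sub>M {1..<t} Q)"
    using f \<open>{1..t} = insert t {1..<t}\<close> by (intro product_nn_integral_insert) auto
  also have "\<dots> = (\<integral>\<^sup>+ h. \<integral>\<^sup>+ z. F h z \<partial>Q t \<partial>Pi\<^sub>M {1..<t} Q)"
  proof (intro nn_integral_cong)
    fix h z assume "h \<in> space (Pi\<^sub>M {1..<t} Q)"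
    hence "restrict (h(t := z)) {1..<t} = h"
      by (auto simp: space_PiM PiE_iff extensional_def fun_eq_iff)
    thus "f (h(t := z)) = F h z"
      by (simp add: f_def)
  qed
  finally show ?thesis .
qed

section \<open>Decomposition of the total cost into newsvendor costs\<close>

definition net_stage_cost :: "inventory \<Rightarrow> nat \<Rightarrow> real \<Rightarrow> real \<Rightarrow> real" where
  "net_stage_cost P t x d =
     net_backorder_cost P t * max (d - x) 0 + net_holding_cost P t * max (x - d) 0"

lemma measurable_net_stage_cost [measurable]:
  assumes [measurable]: "f \<in> borel_measurable M" "g \<in> borel_measurable M"
  shows "(\<lambda>w. net_stage_cost P t (f w) (g w)) \<in> borel_measurable M"
  unfolding net_stage_cost_def by measurable

text \<open>
  Stock left over from stage \<open>t\<close> saves \<open>\<rho> c\<^bsub>t+1\<^esub>\<close> per unit at the next stage; charging this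
  saving to stage \<open>t\<close> gives a newsvendor cost with the net unit costs.
\<close>

lemma stage_cost_eq_net:
  "order_cost P t * x + stage_cost P t x d =
    order_cost P t * d + net_stage_cost P t x d + discount P * next_order_cost P t * (x - d)"
  by (auto simp: stage_cost_def net_stage_cost_def net_backorder_cost_def net_holding_cost_def
        max_def algebra_simps)

lemma total_cost_eq_net:
  assumes "1 \<le> horizon P"
  shows "total_cost P x d = (\<Sum>t=1..horizon P. discount P ^ (t - 1) *
    (order_cost P t * d t + net_stage_cost P t (x t (history t d)) (d t)))
    - order_cost P 1 * init_level P"
proof -
  \<comment> \<open>The discounted purchase value of the stock at the start of stage
    \<open>t\<close>. Setting it to 0 beyond the horizon matches \<open>next_order_cost\<close>, so
    the telescoping sum leaves only the value of the initial stock.\<close>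
  define u where "u = (\<lambda>t. if t \<le> horizon P
    then discount P ^ (t - 1) * order_cost P t * level P x t d else 0)"
  have "total_cost P x d = (\<Sum>t=1..horizon P. discount P ^ (t - 1) *
    (order_cost P t * d t + net_stage_cost P t (x t (history t d)) (d t)) + (u (Suc t) - u t))"
    unfolding total_cost_def
  proof (intro sum.cong refl)
    fix t assume t: "t \<in> {1..horizon P}"
    hence "level P x (Suc t) d = x t (history t d) - d t" "discount P ^ t = discount P ^ (t - 1) * discount P"
      by (auto simp: level_def power_eq_if)
    hence "u (Suc t) = discount P ^ (t - 1) *
        (discount P * next_order_cost P t * (x t (history t d) - d t))"
      by (simp add: u_def next_order_cost_def)
    moreover have "u t = discount P ^ (t - 1) * (order_cost P t * level P x t d)"
      using t by (simp add: u_def)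
    moreover have "order_cost P t * (x t (history t d) - level P x t d)
          + stage_cost P t (x t (history t d)) (d t) =
        order_cost P t * d t + net_stage_cost P t (x t (history t d)) (d t) +
        discount P * next_order_cost P t * (x t (history t d) - d t) - order_cost P t * level P x t d"
      using stage_cost_eq_net[of P t "x t (history t d)" "d t"] by (simp add: algebra_simps)
    ultimately show "discount P ^ (t - 1) * (order_cost P t * (x t (history t d) - level P x t d)
          + stage_cost P t (x t (history t d)) (d t)) =
        discount P ^ (t - 1) *
          (order_cost P t * d t + net_stage_cost P t (x t (history t d)) (d t)) + (u (Suc t) - u t)"
      by (simp only:) (simp add: algebra_simps)
  qed
  also have "\<dots> = (\<Sum>t=1..horizon P. discount P ^ (t - 1) *
    (order_cost P t * d t + net_stage_cost P t (x t (history t d)) (d t)))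
    + (u (Suc (horizon P)) - u 1)"
    using sum_Suc_diff[of 1 "horizon P" u] by (simp add: sum.distrib)
  finally show ?thesis
    using assms by (simp add: u_def level_def)
qed

text \<open>
  Policies are measurable only on nonnegative histories; truncating the history at \<open>0\<close> extends
  them to a measurable function of all histories.
\<close>

definition clip :: "policy \<Rightarrow> nat \<Rightarrow> (nat \<Rightarrow> real) \<Rightarrow> real" where
  "clip x t h = x t (\<lambda>s\<in>{1..<t}. max 0 (h s))"

lemma measurable_clip:
  assumes "x \<in> policies P" "t \<in> {1..horizon P}"
  shows "clip x t \<in> borel_measurable (Pi\<^sub>M {1..<t} (\<lambda>_. borel))"
proof -
  have "(\<lambda>h. \<lambda>s\<in>{1..<t}. max 0 (h s)) \<in>
      measurable (Pi\<^sub>M {1..<t} (\<lambda>_. borel :: real measure))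
        (Pi\<^sub>M {1..<t} (\<lambda>_. restrict_space borel {0..}))"
    by (intro measurable_restrict measurable_restrict_space2) auto
  moreover have "x t \<in> borel_measurable (Pi\<^sub>M {1..<t} (\<lambda>_. restrict_space borel {0..}))"
    using assms by (auto simp: policies_def)
  ultimately have "(\<lambda>h. x t (\<lambda>s\<in>{1..<t}. max 0 (h s))) \<in> borel_measurable (Pi\<^sub>M {1..<t} (\<lambda>_. borel))"
    by (rule measurable_compose)
  thus ?thesis
    by (simp add: clip_def[abs_def])
qed

lemma clip_eq: "h \<in> histories t \<Longrightarrow> clip x t h = x t h"
  unfolding clip_def histories_def
  by (intro arg_cong[of _ _ "x t"]) (auto simp: fun_eq_iff PiE_iff extensional_def)

lemma clip_mem: "(\<lambda>s\<in>{1..<t}. max 0 (h s)) \<in> histories t"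
  by (auto simp: histories_def)

lemma history_mem: "(\<And>s. s \<in> {1..<t} \<Longrightarrow> 0 \<le> d s) \<Longrightarrow> history t d \<in> histories t"
  by (auto simp: histories_def history_def)

text \<open>The stage \<open>t\<close> summand of \<open>total_cost_eq_net\<close>, averaged over
  the current demand alone; the level is a number because the history is integrated
  separately.\<close>

definition expected_stage :: "inventory \<Rightarrow> nat \<Rightarrow> real measure \<Rightarrow> real \<Rightarrow> ennreal" where
  "expected_stage P t Q x = (\<integral>\<^sup>+ d. ennreal (discount P ^ (t - 1) *
     (order_cost P t * d + net_stage_cost P t x d)) \<partial>Q)"

lemma AE_product_nonneg:
  fixes T :: nat
  assumes "\<And>t. prob_space (Q t)" and "\<And>t. t \<in> {1..T} \<Longrightarrow> AE d in Q t. (0::real) \<le> d"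
  shows "AE d in Pi\<^sub>M {1..T} Q. \<forall>t\<in>{1..T}. 0 \<le> d t"
  by (intro AE_finite_allI AE_PiM_component assms) simp_all

lemma marginalsD:
  assumes "Q \<in> marginals P t"
  shows "prob_space Q" "sets Q = sets borel"
  using assms by (auto simp: marginals_def)

text \<open>Outside the horizon the marginals are replaced by a Dirac measure, so that every factor
  is a probability measure on the Borel sets.\<close>

lemma ambiguity_setE:
  assumes "R \<in> ambiguity_set P"
  obtains Q where "R = Pi\<^sub>M {1..horizon P} Q" "\<And>t. prob_space (Q t)" "\<And>t. sets (Q t) = sets borel"
    "\<And>t. t \<in> {1..horizon P} \<Longrightarrow> Q t \<in> marginals P t"
proof -
  from assms obtain Q where Q: "R = Pi\<^sub>M {1..horizon P} Q"
      "\<And>t. t \<in> {1..horizon P} \<Longrightarrow> Q t \<in> marginals P t"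
    by (auto simp: ambiguity_set_def)
  show thesis
  proof (rule that[of "\<lambda>t. if t \<in> {1..horizon P} then Q t else return borel 0"])
    show "R = Pi\<^sub>M {1..horizon P} (\<lambda>t. if t \<in> {1..horizon P} then Q t else return borel 0)"
      unfolding Q(1) by (intro PiM_cong) auto
  qed (use Q in \<open>auto intro: prob_space_return dest: marginalsD\<close>)
qed

text \<open>The last condition is the high-variation case of Scarf's newsvendor with known mean and
  variance, where the robust order quantity is 0.\<close>

locale scarf_regime =
  fixes P :: inventory
  assumes model: "inventory_model P"
    and net_backorder_pos: "\<And>t. t \<in> {1..horizon P} \<Longrightarrow> net_backorder_cost P t > 0"
    and net_holding_pos: "\<And>t. t \<in> {1..horizon P} \<Longrightarrow> net_holding_cost P t > 0"
    and sd_pos: "\<And>t. t \<in> {1..horizon P} \<Longrightarrow> demand_sd P t > 0"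
    and mean_pos: "\<And>t. t \<in> {1..horizon P} \<Longrightarrow> demand_mean P t > 0"
    and range_eq: "\<And>t. t \<in> {1..horizon P} \<Longrightarrow> demand_range P t = {0..}"
    and variation: "\<And>t. t \<in> {1..horizon P} \<Longrightarrow>
           (demand_sd P t)\<^sup>2 / (demand_mean P t)\<^sup>2 > net_backorder_cost P t / net_holding_cost P t"
begin

lemma discount_pos: "0 < discount P"
  and horizon_pos: "1 \<le> horizon P"
  and order_cost_pos: "t \<in> {1..horizon P} \<Longrightarrow> 0 < order_cost P t"
  using model by (auto simp: inventory_model_def)

lemma AE_marginal_nonneg: "t \<in> {1..horizon P} \<Longrightarrow> Q \<in> marginals P t \<Longrightarrow> AE d in Q. 0 \<le> d"
  using range_eq[of t] by (auto simp: marginals_def)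

lemma net_stage_cost_nonneg: "t \<in> {1..horizon P} \<Longrightarrow> 0 \<le> net_stage_cost P t x d"
  using net_backorder_pos[of t] net_holding_pos[of t] by (simp add: net_stage_cost_def)

text \<open>Almost surely all demands are nonnegative. Then clipping changes nothing and every
  summand is nonnegative, so \<open>ennreal\<close> commutes with the sum and each stage reduces to
  \<open>nn_integral_history\<close>.\<close>

lemma nn_integral_total_cost:
  assumes x: "x \<in> policies P" and init: "init_level P = 0"
    and prob: "\<And>t. prob_space (Q t)" and sets: "\<And>t. sets (Q t) = sets borel"
    and Q: "\<And>t. t \<in> {1..horizon P} \<Longrightarrow> Q t \<in> marginals P t"
  shows "(\<integral>\<^sup>+ d. ennreal (total_cost P x d) \<partial>Pi\<^sub>M {1..horizon P} Q) =
    (\<Sum>t=1..horizon P. \<integral>\<^sup>+ h. expected_stage P t (Q t) (clip x t h) \<partial>Pi\<^sub>M {1..<t} Q)"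
proof -
  define F where "F = (\<lambda>t h z. ennreal (discount P ^ (t - 1) *
    (order_cost P t * z + net_stage_cost P t (clip x t h) z)))"
  have F: "case_prod (F t) \<in> borel_measurable (Pi\<^sub>M {1..<t} (\<lambda>_. borel) \<Otimes>\<^sub>M borel)"
    if "t \<in> {1..horizon P}" for t
  proof -
    note [measurable] = measurable_clip[OF x that]
    show ?thesis
      unfolding F_def by measurable
  qed
  have sets': "sets (Pi\<^sub>M I Q) = sets (Pi\<^sub>M I (\<lambda>_. borel))" for I :: "nat set"
    by (intro sets_PiM_cong) (auto simp: sets)
  have "AE d in Pi\<^sub>M {1..horizon P} Q. \<forall>t\<in>{1..horizon P}. 0 \<le> d t"
    using AE_marginal_nonneg Q by (intro AE_product_nonneg prob) auto
  hence "AE d in Pi\<^sub>M {1..horizon P} Q. ennreal (total_cost P x d) =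
      (\<Sum>t=1..horizon P. F t (history t d) (d t))"
  proof eventually_elim
    case (elim d)
    have "clip x t (history t d) = x t (history t d)" if "t \<in> {1..horizon P}" for t
      using elim that by (intro clip_eq history_mem) auto
    thus ?case
      unfolding F_def using elim net_stage_cost_nonneg discount_pos order_cost_pos init
      by (subst sum_ennreal)
        (auto simp: total_cost_eq_net[OF horizon_pos] less_imp_le intro!: sum.cong arg_cong[of _ _ ennreal])
  qed
  hence "(\<integral>\<^sup>+ d. ennreal (total_cost P x d) \<partial>Pi\<^sub>M {1..horizon P} Q) =
      (\<integral>\<^sup>+ d. (\<Sum>t=1..horizon P. F t (history t d) (d t)) \<partial>Pi\<^sub>M {1..horizon P} Q)"
    by (rule nn_integral_cong_AE)
  also have "\<dots> = (\<Sum>t=1..horizon P. \<integral>\<^sup>+ d. F t (history t d) (d t) \<partial>Pi\<^sub>M {1..horizon P} Q)"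
  proof (intro nn_integral_sum)
    fix t assume t: "t \<in> {1..horizon P}"
    have "(\<lambda>d. restrict d {1..<t}) \<in> measurable (Pi\<^sub>M {1..horizon P} (\<lambda>_. borel)) (Pi\<^sub>M {1..<t} (\<lambda>_. borel :: real measure))"
      using t by (intro measurable_restrict_subset) auto
    moreover have "(\<lambda>d. d t) \<in> borel_measurable (Pi\<^sub>M {1..horizon P} (\<lambda>_. borel :: real measure))"
      using t by (intro measurable_component_singleton)
    ultimately have "(\<lambda>d. (restrict d {1..<t}, d t)) \<in>
        measurable (Pi\<^sub>M {1..horizon P} (\<lambda>_. borel :: real measure))
          (Pi\<^sub>M {1..<t} (\<lambda>_. borel) \<Otimes>\<^sub>M borel)"
      by (rule measurable_Pair)
    from measurable_compose[OF this F[OF t]]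
    show "(\<lambda>d. F t (history t d) (d t)) \<in> borel_measurable (Pi\<^sub>M {1..horizon P} Q)"
      by (simp add: history_def measurable_cong_sets[OF sets' refl])
  qed
  also have "\<dots> = (\<Sum>t=1..horizon P. \<integral>\<^sup>+ h. expected_stage P t (Q t) (clip x t h) \<partial>Pi\<^sub>M {1..<t} Q)"
    using nn_integral_history[OF prob sets F] by (intro sum.cong) (auto simp: F_def expected_stage_def)
  finally show ?thesis .
qed

subsection \<open>The critical two-point law\<close>

text \<open>The law with the given moments that puts as much mass as possible at \<open>0\<close>.\<close>

definition critical_law :: "nat \<Rightarrow> real measure" where
  "critical_law t = (let m = demand_mean P t; v = (demand_sd P t)\<^sup>2; s = m\<^sup>2 + v in
     finite_law [v / s, m\<^sup>2 / s] [0, s / m])"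

lemma critical_law_mem:
  assumes t: "t \<in> {1..horizon P}"
  shows "critical_law t \<in> marginals P t"
proof -
  define m v where "m = demand_mean P t" and "v = (demand_sd P t)\<^sup>2"
  have pos: "0 < m" "0 < v"
    using mean_pos[OF t] sd_pos[OF t] by (auto simp: m_def v_def)
  have s: "0 < m\<^sup>2 + v"
    using pos by (simp add: add_pos_pos)
  have "finite_law [v / (m\<^sup>2 + v), m\<^sup>2 / (m\<^sup>2 + v)] [0, (m\<^sup>2 + v) / m] \<in> marginals P t"
  proof (rule finite_law_mem_marginals)
    fix i assume "i < length [0, (m\<^sup>2 + v) / m]"
    hence "i = 0 \<or> i = 1" by auto
    thus "0 \<le> [v / (m\<^sup>2 + v), m\<^sup>2 / (m\<^sup>2 + v)] ! i" "0 \<le> [0, (m\<^sup>2 + v) / m] ! i"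
      using pos by auto
  next
    show "(\<Sum>i<length [0, (m\<^sup>2 + v) / m]. [v / (m\<^sup>2 + v), m\<^sup>2 / (m\<^sup>2 + v)] ! i) = 1"
      using s by (simp add: add_divide_distrib[symmetric])
    show "(\<Sum>i<length [0, (m\<^sup>2 + v) / m]. [v / (m\<^sup>2 + v), m\<^sup>2 / (m\<^sup>2 + v)] ! i *
        [0, (m\<^sup>2 + v) / m] ! i) = demand_mean P t"
      using s pos by (simp add: m_def[symmetric] power2_eq_square)
    show "(\<Sum>i<length [0, (m\<^sup>2 + v) / m]. [v / (m\<^sup>2 + v), m\<^sup>2 / (m\<^sup>2 + v)] ! i *
        ([0, (m\<^sup>2 + v) / m] ! i)\<^sup>2) = (demand_mean P t)\<^sup>2 + (demand_sd P t)\<^sup>2"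
      unfolding m_def[symmetric] v_def[symmetric] using s pos by (simp add: power_divide power2_eq_square)
  qed (rule range_eq[OF t])
  thus ?thesis
    by (simp add: critical_law_def Let_def m_def v_def)
qed

text \<open>Raising the level from 0 to \<open>x\<close> costs \<open>p * h * x\<close> in holding
  and saves at most \<open>q * b * x\<close> in backorders, and the variation hypothesis says
  \<open>q * b < p * h\<close>; a negative level adds backorders at both atoms. The bound is a real
  \<open>a\<close> because the affine terms can make it negative, and \<open>ennreal\<close> would
  then lose strictness.\<close>

lemma critical_law_bound:
  assumes t: "t \<in> {1..horizon P}" and k: "0 < k"
  obtains a where "ennreal a \<le> (\<integral>\<^sup>+ d. ennreal (k * net_stage_cost P t x d + \<alpha> + \<beta> * d) \<partial>critical_law t)"
    and "k * (net_backorder_cost P t * demand_mean P t) + \<alpha> + \<beta> * demand_mean P t \<le> a"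
    and "x \<noteq> 0 \<Longrightarrow> k * (net_backorder_cost P t * demand_mean P t) + \<alpha> + \<beta> * demand_mean P t < a"
proof -
  define m v where "m = demand_mean P t" and "v = (demand_sd P t)\<^sup>2"
  define b h where "b = net_backorder_cost P t" and "h = net_holding_cost P t"
  define p q c where "p = v / (m\<^sup>2 + v)" and "q = m\<^sup>2 / (m\<^sup>2 + v)" and "c = (m\<^sup>2 + v) / m"
  have pos: "0 < m" "0 < v" "0 < b" "0 < h"
    using mean_pos[OF t] sd_pos[OF t] net_backorder_pos[OF t] net_holding_pos[OF t]
    by (auto simp: m_def v_def b_def h_def)
  have s: "0 < m\<^sup>2 + v"
    using pos by (simp add: add_pos_pos)
  have pq: "0 < p" "0 < q" "0 < c" "p + q = 1" "q * c = m"
    using pos s by (auto simp: p_def q_def c_def add_divide_distrib[symmetric] power2_eq_square)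
  have "q * b < p * h"
  proof -
    have "b / h < v / m\<^sup>2"
      using variation[OF t] by (simp add: b_def h_def v_def m_def)
    hence "m\<^sup>2 * b < v * h"
      using pos by (simp add: field_simps)
    thus ?thesis
      using s by (simp add: p_def q_def divide_strict_right_mono)
  qed
  define f where "f = net_stage_cost P t x"
  have f: "b * m \<le> p * f 0 + q * f c \<and> (x \<noteq> 0 \<longrightarrow> b * m < p * f 0 + q * f c)"
  proof (cases "0 \<le> x")
    case True
    \<comment> \<open>This linear bound holds on both sides of the upper atom \<open>c\<close>, so
      \<open>x > c\<close> needs no separate case.\<close>
    have "b * (c - x) \<le> b * max (c - x) 0" "0 \<le> h * max (x - c) 0"
      using pos by auto
    hence "b * (c - x) \<le> f c"
      by (simp add: f_def net_stage_cost_def b_def h_def)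
    hence "q * (b * (c - x)) \<le> q * f c"
      using pq by simp
    moreover have "f 0 = h * x"
      using True by (simp add: f_def net_stage_cost_def h_def)
    moreover have "q * (b * (c - x)) + p * (h * x) = b * m + x * (p * h - q * b)"
      by (simp add: pq(5)[symmetric] algebra_simps)
    moreover have "0 \<le> x * (p * h - q * b)" "x \<noteq> 0 \<Longrightarrow> 0 < x * (p * h - q * b)"
      using True \<open>q * b < p * h\<close> by auto
    ultimately show ?thesis
      by auto
  next
    case False
    hence "f 0 = b * (0 - x)" "f c = b * (c - x)"
      using pq by (auto simp: f_def net_stage_cost_def b_def)
    hence "p * f 0 + q * f c = b * (q * c) - (p + q) * (b * x)"
      by (simp only:) (simp add: algebra_simps)
    hence "p * f 0 + q * f c = b * m - b * x"
      unfolding pq by simp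
    thus ?thesis
      using mult_pos_neg[of b x] False pos by simp
  qed
  define g where "g = (\<lambda>d. k * f d + \<alpha> + \<beta> * d)"
  have "(\<integral>\<^sup>+ d. ennreal (g d) \<partial>critical_law t) = ennreal p * ennreal (g 0) + ennreal q * ennreal (g c)"
    unfolding critical_law_def Let_def m_def[symmetric] v_def[symmetric]
      p_def[symmetric] q_def[symmetric] c_def[symmetric]
    by (subst nn_integral_finite_law) (auto simp: g_def f_def)
  also have "\<dots> = ennreal (p * g 0) + ennreal (q * g c)"
    using pq by (simp add: ennreal_mult')
  also have "\<dots> \<ge> ennreal (p * g 0 + q * g c)"
    by (rule ennreal_add_ge)
  also have "p * g 0 + q * g c = k * (p * f 0 + q * f c) + (p + q) * \<alpha> + \<beta> * (q * c)"
    by (simp add: g_def algebra_simps)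
  also have "\<dots> = k * (p * f 0 + q * f c) + \<alpha> + \<beta> * m"
    unfolding pq by simp
  finally show thesis
    using f k by (intro that[of "k * (p * f 0 + q * f c) + \<alpha> + \<beta> * m"])
      (auto simp: g_def f_def m_def b_def)
qed

text \<open>The expected cost of stage \<open>t\<close> at level 0, the same for all marginals by
  \<open>expected_stage_zero\<close>.\<close>

definition stage_bound :: "nat \<Rightarrow> real" where
  "stage_bound t = discount P ^ (t - 1) * ((order_cost P t + net_backorder_cost P t) * demand_mean P t)"

lemma stage_bound_nonneg: "t \<in> {1..horizon P} \<Longrightarrow> 0 \<le> stage_bound t"
  unfolding stage_bound_def
  using discount_pos order_cost_pos net_backorder_pos mean_pos by (simp add: less_imp_le)

lemma expected_stage_critical:
  assumes t: "t \<in> {1..horizon P}"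
  shows expected_stage_critical_ge: "ennreal (stage_bound t) \<le> expected_stage P t (critical_law t) x"
    and expected_stage_critical_gt:
      "x \<noteq> 0 \<Longrightarrow> ennreal (stage_bound t) < expected_stage P t (critical_law t) x"
proof -
  define k where "k = discount P ^ (t - 1)"
  have k: "0 < k"
    using discount_pos by (simp add: k_def)
  have eq: "k * (order_cost P t * d + net_stage_cost P t x d) =
      k * net_stage_cost P t x d + 0 + k * order_cost P t * d" for d
    by (simp add: algebra_simps)
  have bound: "stage_bound t = k * (net_backorder_cost P t * demand_mean P t) + 0
      + k * order_cost P t * demand_mean P t"
    by (simp add: stage_bound_def k_def algebra_simps)
  obtain a where "ennreal a \<le> expected_stage P t (critical_law t) x" "stage_bound t \<le> a"
      "x \<noteq> 0 \<Longrightarrow> stage_bound t < a"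
    using critical_law_bound[OF t k, of x 0 "k * order_cost P t"]
    unfolding expected_stage_def k_def[symmetric] eq bound by blast
  \<comment> \<open>Strictness survives the passage to \<open>ennreal\<close> because the smaller
    side is nonnegative.\<close>
  moreover from this have "x \<noteq> 0 \<Longrightarrow> ennreal (stage_bound t) < ennreal a"
    using stage_bound_nonneg[OF t] by (simp add: ennreal_less_iff)
  ultimately show "ennreal (stage_bound t) \<le> expected_stage P t (critical_law t) x"
    and "x \<noteq> 0 \<Longrightarrow> ennreal (stage_bound t) < expected_stage P t (critical_law t) x"
    by (auto intro: order_trans ennreal_leI less_le_trans)
qed

lemma nn_integral_marginal_affine:
  assumes t: "t \<in> {1..horizon P}" and Q: "Q \<in> marginals P t" and "0 \<le> \<alpha>" "0 \<le> \<beta>"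
  shows "(\<integral>\<^sup>+ d. ennreal (\<alpha> + \<beta> * d) \<partial>Q) = ennreal (\<alpha> + \<beta> * demand_mean P t)"
proof -
  from Q interpret prob_space Q
    by (rule marginalsD)
  have [simp]: "integrable Q (\<lambda>d. d)" "(\<integral>d. d \<partial>Q) = demand_mean P t"
    using Q by (auto simp: marginals_def)
  have "AE d in Q. 0 \<le> \<alpha> + \<beta> * d"
    using AE_marginal_nonneg[OF t Q] by eventually_elim (use assms(3,4) in auto)
  hence "(\<integral>\<^sup>+ d. ennreal (\<alpha> + \<beta> * d) \<partial>Q) = ennreal (\<integral>d. \<alpha> + \<beta> * d \<partial>Q)"
    by (intro nn_integral_eq_integral) auto
  thus ?thesis
    by (simp add: prob_space)
qed

text \<open>Demand is almost surely nonnegative, so at level 0 there are only backorders: the cost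
  is linear in the demand and only the mean enters.\<close>

lemma expected_stage_zero:
  assumes t: "t \<in> {1..horizon P}" and Q: "Q \<in> marginals P t"
  shows "expected_stage P t Q 0 = ennreal (stage_bound t)"
proof -
  define \<beta> where "\<beta> = discount P ^ (t - 1) * (order_cost P t + net_backorder_cost P t)"
  have "AE d in Q. discount P ^ (t - 1) * (order_cost P t * d + net_stage_cost P t 0 d) = 0 + \<beta> * d"
    using AE_marginal_nonneg[OF t Q]
    by eventually_elim (simp add: net_stage_cost_def \<beta>_def algebra_simps)
  hence "expected_stage P t Q 0 = (\<integral>\<^sup>+ d. ennreal (0 + \<beta> * d) \<partial>Q)"
    unfolding expected_stage_def by (intro nn_integral_cong_AE) auto
  also have "\<dots> = ennreal (0 + \<beta> * demand_mean P t)"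
    using discount_pos order_cost_pos[OF t] net_backorder_pos[OF t]
    by (intro nn_integral_marginal_affine[OF t Q]) (auto simp: \<beta>_def less_imp_le)
  finally show ?thesis
    by (simp add: stage_bound_def \<beta>_def mult.assoc)
qed

subsection \<open>The dynamic programme\<close>

text \<open>One backward step of the lower bound, with the supremum bounded below by its value at
  the critical law. An affine continuation of slope \<open>- next_order_cost P t\<close> turns the
  stage cost into the net one, and the purchase cost of \<open>x\<close> cancels, so the bound is
  uniform in \<open>x\<close>.\<close>

lemma dp_objective_ge:
  assumes t: "t \<in> {1..horizon P}"
    and W: "\<And>z. ennreal (\<kappa> - next_order_cost P t * z) \<le> W z"
  shows "ennreal ((order_cost P t + net_backorder_cost P t) * demand_mean P t + discount P * \<kappa>
    - order_cost P t * y) \<le> dp_objective P t W y x"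
proof -
  define \<alpha> where "\<alpha> = discount P * \<kappa> - order_cost P t * x"
  obtain a where a: "ennreal a \<le> (\<integral>\<^sup>+ d. ennreal (1 * net_stage_cost P t x d + \<alpha> + order_cost P t * d) \<partial>critical_law t)"
      "1 * (net_backorder_cost P t * demand_mean P t) + \<alpha> + order_cost P t * demand_mean P t \<le> a"
    using critical_law_bound[OF t zero_less_one] by blast
  have "(order_cost P t + net_backorder_cost P t) * demand_mean P t + discount P * \<kappa>
      - order_cost P t * y \<le> order_cost P t * (x - y) + a"
    using a(2) by (simp add: \<alpha>_def algebra_simps)
  hence "ennreal ((order_cost P t + net_backorder_cost P t) * demand_mean P t + discount P * \<kappa>
      - order_cost P t * y) \<le> ennreal (order_cost P t * (x - y) + a)"
    by (rule ennreal_leI)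
  also have "\<dots> \<le> ennreal (order_cost P t * (x - y)) + ennreal a"
    by (rule ennreal_add_ge)
  also have "ennreal a \<le> (\<integral>\<^sup>+ d. ennreal (stage_cost P t x d) + ennreal (discount P) * W (x - d) \<partial>critical_law t)"
  proof (rule order_trans[OF a(1)], rule nn_integral_mono)
    fix d
    have "1 * net_stage_cost P t x d + \<alpha> + order_cost P t * d =
        stage_cost P t x d + discount P * (\<kappa> - next_order_cost P t * (x - d))"
      using stage_cost_eq_net[of P t x d] by (simp add: \<alpha>_def algebra_simps)
    also have "ennreal \<dots> \<le> ennreal (stage_cost P t x d)
        + ennreal (discount P * (\<kappa> - next_order_cost P t * (x - d)))"
      by (rule ennreal_add_ge)
    also have "ennreal (discount P * (\<kappa> - next_order_cost P t * (x - d))) =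
        ennreal (discount P) * ennreal (\<kappa> - next_order_cost P t * (x - d))"
      using discount_pos by (simp add: ennreal_mult')
    also have "\<dots> \<le> ennreal (discount P) * W (x - d)"
      by (intro mult_left_mono W) auto
    finally show "ennreal (1 * net_stage_cost P t x d + \<alpha> + order_cost P t * d) \<le>
        ennreal (stage_cost P t x d) + ennreal (discount P) * W (x - d)"
      by (simp add: add_left_mono)
  qed
  also have "\<dots> \<le> (SUP Q\<in>marginals P t.
      \<integral>\<^sup>+ d. ennreal (stage_cost P t x d) + ennreal (discount P) * W (x - d) \<partial>Q)"
    by (intro SUP_upper critical_law_mem t)
  finally show ?thesis
    by (simp add: dp_objective_def add_left_mono)
qed

lemma next_order_cost_nonneg: "0 \<le> next_order_cost P t"
  using order_cost_pos[of "Suc t"] by (auto simp: next_order_cost_def less_imp_le)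

text \<open>From level 0 the next inventory is \<open>- d\<close>, almost surely nonpositive, where
  \<open>W\<close> is known exactly. The integrand is affine in the demand, so all marginals give
  the same value.\<close>

lemma dp_objective_zero:
  assumes t: "t \<in> {1..horizon P}" and y: "y \<le> 0" and \<kappa>: "0 \<le> \<kappa>"
    and W: "\<And>z. z \<le> 0 \<Longrightarrow> W z = ennreal (\<kappa> - next_order_cost P t * z)"
  shows "dp_objective P t W y 0 =
    ennreal ((order_cost P t + net_backorder_cost P t) * demand_mean P t + discount P * \<kappa>
    - order_cost P t * y)"
proof -
  note nonneg = discount_pos[THEN less_imp_le] \<kappa> order_cost_pos[OF t, THEN less_imp_le]
    net_backorder_pos[OF t, THEN less_imp_le] mean_pos[OF t, THEN less_imp_le] next_order_cost_nonneg[of t]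
  have b: "backorder_cost P t + discount P * next_order_cost P t = order_cost P t + net_backorder_cost P t"
    by (simp add: net_backorder_cost_def)
  have "(\<integral>\<^sup>+ d. ennreal (stage_cost P t 0 d) + ennreal (discount P) * W (0 - d) \<partial>Q) =
      ennreal (discount P * \<kappa> + (order_cost P t + net_backorder_cost P t) * demand_mean P t)"
    if Q: "Q \<in> marginals P t" for Q
  proof -
    have "AE d in Q. ennreal (stage_cost P t 0 d) + ennreal (discount P) * W (0 - d) =
        ennreal (discount P * \<kappa> + (order_cost P t + net_backorder_cost P t) * d)"
      using AE_marginal_nonneg[OF t Q]
    proof eventually_elim
      case (elim d)
      have "order_cost P t < backorder_cost P t"
        using model t by (simp add: inventory_model_def)
      hence "0 \<le> backorder_cost P t"
        using order_cost_pos[OF t] by simp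
      hence "stage_cost P t 0 d = backorder_cost P t * d" "0 \<le> stage_cost P t 0 d"
        using elim by (auto simp: stage_cost_def)
      moreover have "0 \<le> \<kappa> + next_order_cost P t * d"
        using nonneg elim by simp
      ultimately show ?case
        using nonneg elim W[of "- d"]
        by (simp add: b[symmetric] ennreal_mult'[symmetric] ennreal_plus[symmetric] algebra_simps
              del: ennreal_plus)
    qed
    hence "(\<integral>\<^sup>+ d. ennreal (stage_cost P t 0 d) + ennreal (discount P) * W (0 - d) \<partial>Q) =
        (\<integral>\<^sup>+ d. ennreal (discount P * \<kappa> + (order_cost P t + net_backorder_cost P t) * d) \<partial>Q)"
      by (rule nn_integral_cong_AE)
    thus ?thesis
      using nonneg by (simp add: nn_integral_marginal_affine[OF t Q])
  qed
  \<comment> \<open>Over an empty set the supremum would be 0 instead of the common value.\<close>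
  moreover have "marginals P t \<noteq> {}"
    using critical_law_mem[OF t] by auto
  ultimately have "dp_objective P t W y 0 = ennreal (order_cost P t * (0 - y))
      + ennreal (discount P * \<kappa> + (order_cost P t + net_backorder_cost P t) * demand_mean P t)"
    by (simp add: dp_objective_def)
  also have "\<dots> = ennreal (order_cost P t * (0 - y)
      + (discount P * \<kappa> + (order_cost P t + net_backorder_cost P t) * demand_mean P t))"
    using nonneg y by (intro ennreal_plus[symmetric]) (auto simp: mult_nonneg_nonpos)
  finally show ?thesis
    by (simp add: algebra_simps)
qed

text \<open>Backward induction with the two preceding lemmas; \<open>\<kappa>\<close> is the value
  at inventory 0. The index \<open>t - 1\<close> gives the ordering cost of stage \<open>t\<close>
  up to the horizon and 0 just after it, so the base case has the same form.\<close>

lemma dp_value_affine: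
  assumes "1 \<le> t" "t \<le> Suc (horizon P)"
  shows "\<exists>\<kappa>\<ge>0. (\<forall>y. ennreal (\<kappa> - next_order_cost P (t - 1) * y) \<le> dp_value P t y) \<and>
    (\<forall>y\<le>0. dp_value P t y = ennreal (\<kappa> - next_order_cost P (t - 1) * y))"
  using assms(2,1)
proof (induction t rule: inc_induct)
  case base
  show ?case
    by (intro exI[of _ 0]) (auto simp: next_order_cost_def dp_value.simps)
next
  case (step t)
  hence t: "t \<in> {1..horizon P}" by auto
  from step obtain \<kappa> where \<kappa>: "0 \<le> \<kappa>"
      "\<And>z. ennreal (\<kappa> - next_order_cost P t * z) \<le> dp_value P (Suc t) z"
      "\<And>z. z \<le> 0 \<Longrightarrow> dp_value P (Suc t) z = ennreal (\<kappa> - next_order_cost P t * z)"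
    by auto
  define \<kappa>' where "\<kappa>' = (order_cost P t + net_backorder_cost P t) * demand_mean P t + discount P * \<kappa>"
  have "0 \<le> \<kappa>'"
    using \<kappa> discount_pos order_cost_pos[OF t] net_backorder_pos[OF t] mean_pos[OF t]
    by (simp add: \<kappa>'_def less_imp_le)
  moreover have c: "next_order_cost P (t - 1) = order_cost P t"
    using t by (auto simp: next_order_cost_def)
  have value_eq: "dp_value P t y = (INF x\<in>{y..}. dp_objective P t (dp_value P (Suc t)) y x)" for y
    using t by (subst dp_value.simps) auto
  have ge: "ennreal (\<kappa>' - order_cost P t * y) \<le> dp_value P t y" for y
    unfolding value_eq \<kappa>'_def by (intro INF_greatest dp_objective_ge t \<kappa>)
  moreover have "dp_value P t y = ennreal (\<kappa>' - order_cost P t * y)" if "y \<le> 0" for y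
  proof (rule antisym[OF _ ge])
    have "dp_value P t y \<le> dp_objective P t (dp_value P (Suc t)) y 0"
      unfolding value_eq using that by (intro INF_lower) auto
    thus "dp_value P t y \<le> ennreal (\<kappa>' - order_cost P t * y)"
      by (simp add: dp_objective_zero[OF t that \<kappa>(1,3)] \<kappa>'_def)
  qed
  ultimately show ?case
    unfolding c by blast
qed

text \<open>The uniform lower bound of \<open>dp_objective_ge\<close> is attained at 0.\<close>

lemma zero_mem_dp_minimizers:
  assumes t: "t \<in> {1..horizon P}" and y: "y \<le> 0"
  shows "0 \<in> dp_minimizers P t y"
proof -
  from dp_value_affine[of "Suc t"] t obtain \<kappa> where \<kappa>: "0 \<le> \<kappa>"
      "\<And>z. ennreal (\<kappa> - next_order_cost P t * z) \<le> dp_value P (Suc t) z"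
      "\<And>z. z \<le> 0 \<Longrightarrow> dp_value P (Suc t) z = ennreal (\<kappa> - next_order_cost P t * z)"
    by auto
  show ?thesis
    unfolding dp_minimizers_def
    using y dp_objective_ge[OF t \<kappa>(2), of y] by (simp add: dp_objective_zero[OF t y \<kappa>(1,3)])
qed

subsection \<open>The multistage-static problem\<close>

lemma level_nonpos:
  assumes "init_level P = 0" "1 \<le> t" "d \<in> histories t"
    and "\<And>s. s \<in> {1..<t} \<Longrightarrow> x s (history s d) = 0"
  shows "level P x t d \<le> 0"
  using assms by (auto simp: level_def histories_def PiE_iff)

lemma history_histories: "d \<in> histories t \<Longrightarrow> s \<le> t \<Longrightarrow> history s d \<in> histories s"
  by (intro history_mem) (auto simp: histories_def PiE_iff)

text \<open>If all earlier levels are 0, the inventory is the initial 0 or minus the last demand,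
  hence nonpositive, and the conditional requirement applies at every history.\<close>

lemma zero_policies_eq:
  assumes init: "init_level P = 0"
  shows "zero_policies P = {x \<in> policies P. \<forall>t\<in>{1..horizon P}. \<forall>d\<in>histories t. x t d = 0}"
proof -
  have "x t d = 0" if x: "x \<in> zero_policies P" and "t \<in> {1..horizon P}" "d \<in> histories t" for x t d
    using that(2,3)
  proof (induction t arbitrary: d rule: less_induct)
    case (less t)
    have "x s (history s d) = 0" if "s \<in> {1..<t}" for s
      using less.prems that by (intro less.IH history_histories[of d t]) auto
    with less.prems have "level P x t d \<le> 0"
      by (intro level_nonpos[OF init]) simp_all
    thus ?case
      using x less.prems by (simp add: zero_policies_def)
  qed
  moreover have "x \<in> zero_policies P"
    if "x \<in> policies P" "\<forall>t\<in>{1..horizon P}. \<forall>d\<in>histories t. x t d = 0" for x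
    using that horizon_pos by (simp add: zero_policies_def)
  moreover have "zero_policies P \<subseteq> policies P"
    by (auto simp: zero_policies_def)
  ultimately show ?thesis
    by blast
qed

definition static_value :: ennreal where
  "static_value = (\<Sum>t=1..horizon P. ennreal (stage_bound t))"

lemma worst_case_cost_zero_policy:
  assumes init: "init_level P = 0" and x: "x \<in> zero_policies P"
  shows "worst_case_cost P x = static_value"
proof -
  have "(\<integral>\<^sup>+ d. ennreal (total_cost P x d) \<partial>R) = static_value" if R: "R \<in> ambiguity_set P" for R
    using R
  proof (rule ambiguity_setE)
    fix Q assume Q: "R = Pi\<^sub>M {1..horizon P} Q" "\<And>t. prob_space (Q t)" "\<And>t. sets (Q t) = sets borel"
      "\<And>t. t \<in> {1..horizon P} \<Longrightarrow> Q t \<in> marginals P t"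
    have "(\<integral>\<^sup>+ h. expected_stage P t (Q t) (clip x t h) \<partial>Pi\<^sub>M {1..<t} Q) = ennreal (stage_bound t)"
      if t: "t \<in> {1..horizon P}" for t
    proof -
      interpret prob_space "Pi\<^sub>M {1..<t} Q"
        by (intro prob_space_PiM Q)
      have "clip x t h = 0" for h
        using x t clip_mem[where t = t and h = h] by (auto simp: zero_policies_eq[OF init] clip_def)
      thus ?thesis
        using emeasure_space_1 by (simp add: expected_stage_zero[OF t Q(4)[OF t]])
    qed
    hence "(\<Sum>t=1..horizon P. \<integral>\<^sup>+ h. expected_stage P t (Q t) (clip x t h) \<partial>Pi\<^sub>M {1..<t} Q) = static_value"
      unfolding static_value_def by (intro sum.cong) auto
    moreover have "x \<in> policies P"
      using x by (simp add: zero_policies_def)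
    ultimately show ?thesis
      unfolding Q(1) using nn_integral_total_cost[OF _ init Q(2-4)] by simp
  qed
  moreover have "Pi\<^sub>M {1..horizon P} critical_law \<in> ambiguity_set P"
    using critical_law_mem by (auto simp: ambiguity_set_def)
  ultimately show ?thesis
    unfolding worst_case_cost_def by (intro SUP_eq_const) auto
qed

lemma sum_le_worst_case_cost:
  assumes "init_level P = 0" "x \<in> policies P"
    and prob: "\<And>t. prob_space (Q t)" and sets: "\<And>t. sets (Q t) = sets borel"
    and Q: "\<And>t. t \<in> {1..horizon P} \<Longrightarrow> Q t \<in> marginals P t"
  shows "(\<Sum>t=1..horizon P. \<integral>\<^sup>+ h. expected_stage P t (Q t) (clip x t h) \<partial>Pi\<^sub>M {1..<t} Q)
    \<le> worst_case_cost P x"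
proof -
  have "Pi\<^sub>M {1..horizon P} Q \<in> ambiguity_set P"
    using Q by (auto simp: ambiguity_set_def)
  hence "(\<integral>\<^sup>+ d. ennreal (total_cost P x d) \<partial>Pi\<^sub>M {1..horizon P} Q) \<le> worst_case_cost P x"
    unfolding worst_case_cost_def by (rule SUP_upper)
  thus ?thesis
    by (simp only: nn_integral_total_cost[OF assms(2,1) prob sets Q])
qed

text \<open>Only the marginal of stage \<open>t\<close> is critical; the earlier ones stay free, so
  that \<open>static_value_less\<close> can choose them to reach a given history.\<close>

lemma expected_stage_history_ge:
  assumes "\<And>s. prob_space (Q s)" and "t \<in> {1..horizon P}" "Q t = critical_law t"
  shows "ennreal (stage_bound t) \<le> (\<integral>\<^sup>+ h. expected_stage P t (Q t) (clip x t h) \<partial>Pi\<^sub>M {1..<t} Q)"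
proof -
  interpret prob_space "Pi\<^sub>M {1..<t} Q"
    by (intro prob_space_PiM assms)
  have "ennreal (stage_bound t) = (\<integral>\<^sup>+ h. ennreal (stage_bound t) \<partial>Pi\<^sub>M {1..<t} Q)"
    using emeasure_space_1 by simp
  also have "\<dots> \<le> (\<integral>\<^sup>+ h. expected_stage P t (Q t) (clip x t h) \<partial>Pi\<^sub>M {1..<t} Q)"
    unfolding assms(3) using assms(2) by (intro nn_integral_mono expected_stage_critical_ge)
  finally show ?thesis .
qed

lemma static_value_le:
  assumes "init_level P = 0" "x \<in> policies P"
  shows "static_value \<le> worst_case_cost P x"
proof -
  define Q where "Q = (\<lambda>t. if t \<in> {1..horizon P} then critical_law t else return borel 0)"
  have Q: "prob_space (Q t)" "sets (Q t) = sets borel" for t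
    using critical_law_mem[of t] by (auto simp: Q_def prob_space_return dest: marginalsD)
  have "static_value \<le>
      (\<Sum>t=1..horizon P. \<integral>\<^sup>+ h. expected_stage P t (Q t) (clip x t h) \<partial>Pi\<^sub>M {1..<t} Q)"
    unfolding static_value_def by (intro sum_mono expected_stage_history_ge Q) (auto simp: Q_def)
  also have "\<dots> \<le> worst_case_cost P x"
    using critical_law_mem by (intro sum_le_worst_case_cost assms Q) (auto simp: Q_def)
  finally show ?thesis .
qed

text \<open>
  The optimality conditions only hold almost surely. To reach an individual history, all its
  demands are made atoms of the earlier marginals.
\<close>

lemma static_value_less:
  assumes init: "init_level P = 0" and x: "x \<in> policies P"
    and t: "t \<in> {1..horizon P}" and d: "d \<in> histories t" and "x t d \<noteq> 0"
    and zero: "\<And>s h. s \<in> {1..<t} \<Longrightarrow> h \<in> histories s \<Longrightarrow> x s h = 0"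
  shows "static_value < worst_case_cost P x"
proof -
  have "\<exists>R\<in>marginals P s. emeasure R {d s} > 0" if "s \<in> {1..<t}" for s
    using that t d range_eq mean_pos sd_pos
    by (intro ex_marginal_atom) (auto simp: histories_def PiE_iff)
  then obtain R where R: "\<And>s. s \<in> {1..<t} \<Longrightarrow> R s \<in> marginals P s"
      "\<And>s. s \<in> {1..<t} \<Longrightarrow> emeasure (R s) {d s} > 0"
    by metis
  \<comment> \<open>Laws with atoms along \<open>d\<close> before stage \<open>t\<close>, critical
    laws from \<open>t\<close> on.\<close>
  define Q where "Q = (\<lambda>s. if s \<in> {1..<t} then R s
    else if s \<in> {1..horizon P} then critical_law s else return borel 0)"
  have Q: "prob_space (Q s)" "sets (Q s) = sets borel" for s
    using critical_law_mem[of s] R(1)[of s]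
    by (auto simp: Q_def prob_space_return dest: marginalsD)
  have QM: "Q s \<in> marginals P s" if "s \<in> {1..horizon P}" for s
    using that critical_law_mem R(1) by (auto simp: Q_def)
  interpret prob_space "Q s" for s by (rule Q)
  interpret product_prob_space Q "{1..<t}" ..
  define E where "E = (\<lambda>s. \<integral>\<^sup>+ h. expected_stage P s (Q s) (clip x s h) \<partial>Pi\<^sub>M {1..<s} Q)"
  have ge: "ennreal (stage_bound s) \<le> E s" if s: "s \<in> {1..horizon P}" for s
  proof (cases "s < t")
    case True
    interpret S: prob_space "Pi\<^sub>M {1..<s} Q"
      by (intro prob_space_PiM Q)
    \<comment> \<open>Giving up the critical law before stage \<open>t\<close> loses nothing: at
      level 0 every marginal attains the bound exactly.\<close>
    have "clip x s h = 0" for h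
      using s True zero clip_mem[where t = s and h = h] by (simp add: clip_def)
    thus ?thesis
      using expected_stage_zero[OF s QM[OF s]] S.emeasure_space_1 by (simp add: E_def)
  next
    case False
    thus ?thesis
      unfolding E_def using s by (intro expected_stage_history_ge Q) (auto simp: Q_def)
  qed
  have "ennreal (stage_bound t) < E t"
  proof -
    define G where "G = (\<lambda>h. expected_stage P t (Q t) (clip x t h))"
    have Qt: "Q t = critical_law t"
      using t by (auto simp: Q_def)
    define \<delta> where "\<delta> = G d - ennreal (stage_bound t)"
    have "ennreal (stage_bound t) < G d"
      using expected_stage_critical_gt[OF t \<open>x t d \<noteq> 0\<close>] by (simp add: G_def Qt clip_eq[OF d])
    hence \<delta>: "0 < \<delta>" "ennreal (stage_bound t) + \<delta> = G d"
      by (auto simp: \<delta>_def diff_gr0_ennreal add_diff_inverse_ennreal less_imp_le)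
    \<comment> \<open>As a box, the single history has the product of the atoms as its mass, which
      is positive; the gap \<open>\<delta>\<close> at \<open>d\<close> therefore contributes to the
      integral.\<close>
    have "{d} = (\<Pi>\<^sub>E s\<in>{1..<t}. {d s})"
      using d by (subst PiE_singleton) (auto simp: histories_def PiE_iff)
    hence atom: "{d} \<in> sets (Pi\<^sub>M {1..<t} Q)"
        "emeasure (Pi\<^sub>M {1..<t} Q) {d} = (\<Prod>s\<in>{1..<t}. emeasure (Q s) {d s})"
      using Q(2) by (auto intro!: sets_PiM_I_finite simp: emeasure_PiM)
    have "emeasure (Q s) {d s} \<noteq> 0" if "s \<in> {1..<t}" for s
      using R(2)[OF that] that by (simp add: Q_def)
    hence "emeasure (Pi\<^sub>M {1..<t} Q) {d} \<noteq> 0"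
      unfolding atom(2) by auto
    hence "0 < \<delta> * emeasure (Pi\<^sub>M {1..<t} Q) {d}"
      using \<delta>(1) by (simp add: ennreal_zero_less_mult_iff zero_less_iff_neq_zero)
    hence "ennreal (stage_bound t) + 0 < ennreal (stage_bound t) + \<delta> * emeasure (Pi\<^sub>M {1..<t} Q) {d}"
      by (subst ennreal_add_left_cancel_less) auto
    also have "\<dots> = (\<integral>\<^sup>+ h. ennreal (stage_bound t) + \<delta> * indicator {d} h \<partial>Pi\<^sub>M {1..<t} Q)"
      using atom(1) P.emeasure_space_1 by (simp add: nn_integral_add nn_integral_cmult)
    also have "\<dots> \<le> E t"
      unfolding E_def G_def[symmetric]
    proof (rule nn_integral_mono)
      fix h
      have "ennreal (stage_bound t) \<le> G h"
        unfolding G_def Qt by (rule expected_stage_critical_ge[OF t])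
      thus "ennreal (stage_bound t) + \<delta> * indicator {d} h \<le> G h"
        using \<delta>(2) by (auto simp: indicator_def)
    qed
    finally show ?thesis
      by simp
  qed
  have "static_value = (\<Sum>s\<in>{1..horizon P} - {t}. ennreal (stage_bound s)) + ennreal (stage_bound t)"
    unfolding static_value_def using t by (simp add: sum.remove[of _ t] add.commute)
  also have "\<dots> < (\<Sum>s\<in>{1..horizon P} - {t}. ennreal (stage_bound s)) + E t"
    using \<open>_ < E t\<close> by (subst ennreal_add_left_cancel_less) auto
  also have "\<dots> \<le> (\<Sum>s\<in>{1..horizon P} - {t}. E s) + E t"
    using ge by (intro add_right_mono sum_mono) auto
  also have "\<dots> = (\<Sum>s=1..horizon P. E s)"
    using t by (simp add: sum.remove[of _ t] add.commute)
  also have "\<dots> \<le> worst_case_cost P x"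
    unfolding E_def by (intro sum_le_worst_case_cost init x Q QM)
  finally show ?thesis .
qed

text \<open>Strong induction supplies the zero levels at earlier stages that
  \<open>static_value_less\<close> asks for: the first deviation from 0 already makes the cost
  strictly larger.\<close>

lemma worst_case_cost_eq_static_value_iff:
  assumes init: "init_level P = 0" and x: "x \<in> policies P"
  shows "worst_case_cost P x = static_value \<longleftrightarrow> x \<in> zero_policies P"
proof
  assume eq: "worst_case_cost P x = static_value"
  have "x t d = 0" if "t \<in> {1..horizon P}" "d \<in> histories t" for t d
    using that
  proof (induction t arbitrary: d rule: less_induct)
    case (less t)
    show ?case
    proof (rule ccontr)
      assume "x t d \<noteq> 0"
      hence "static_value < worst_case_cost P x"
        using less.prems by (intro static_value_less[OF init x]) (auto intro: less.IH)
      thus False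
        using eq by simp
    qed
  qed
  thus "x \<in> zero_policies P"
    using x by (simp add: zero_policies_eq[OF init])
qed (rule worst_case_cost_zero_policy[OF init])

text \<open>Admissible because the inventory never exceeds 0; it shows that the infimum is at most
  \<open>static_value\<close>.\<close>

lemma zero_policy:
  assumes init: "init_level P = 0"
  shows "(\<lambda>_ _. 0) \<in> zero_policies P"
proof -
  have "level P (\<lambda>_ _. 0) t d \<le> 0" if "1 \<le> t" "d \<in> histories t" for t d
    using that by (intro level_nonpos[OF init]) auto
  thus ?thesis
    by (auto simp: zero_policies_def policies_def)
qed

lemma optimal_policies_eq:
  assumes init: "init_level P = 0"
  shows "optimal_policies P = zero_policies P"
proof -
  have "(INF x\<in>policies P. worst_case_cost P x) = static_value"
  proof (rule antisym)
    have "(\<lambda>_ _. 0) \<in> policies P"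
      using zero_policy[OF init] by (simp add: zero_policies_def)
    from INF_lower[OF this, of "worst_case_cost P"]
    show "(INF x\<in>policies P. worst_case_cost P x) \<le> static_value"
      by (simp add: worst_case_cost_zero_policy[OF init zero_policy[OF init]])
  qed (intro INF_greatest static_value_le init)
  thus ?thesis
    using worst_case_cost_eq_static_value_iff[OF init]
    by (auto simp: optimal_policies_def zero_policies_def)
qed

text \<open>Along nonnegative demands the inventory stays nonpositive, in the region where 0 is
  known to be a minimizer.\<close>

lemma zero_policy_robust:
  assumes init: "init_level P = 0" and x: "x \<in> zero_policies P"
  shows "robust_wp1_optimal P x"
proof -
  have "AE d in R. \<forall>t\<in>{1..horizon P}. x t (history t d) \<in> dp_minimizers P t (level P x t d)"
    if "R \<in> ambiguity_set P" for R
    using that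
  proof (rule ambiguity_setE)
    fix Q assume Q: "R = Pi\<^sub>M {1..horizon P} Q" "\<And>t. prob_space (Q t)"
      "\<And>t. t \<in> {1..horizon P} \<Longrightarrow> Q t \<in> marginals P t"
    have "AE d in R. \<forall>t\<in>{1..horizon P}. 0 \<le> d t"
      unfolding Q(1) using AE_marginal_nonneg Q(3) by (intro AE_product_nonneg Q(2)) auto
    thus ?thesis
    proof eventually_elim
      case (elim d)
      have zero: "x t (history t d) = 0" if "t \<in> {1..horizon P}" for t
        using x that elim history_mem[of t d] by (auto simp: zero_policies_eq[OF init])
      show ?case
      proof
        fix t assume t: "t \<in> {1..horizon P}"
        have "level P x t d \<le> 0"
        proof (cases "t = 1")
          case False
          hence "t - 1 \<in> {1..horizon P}"
            using t by auto
          thus ?thesis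
            using elim zero False by (simp add: level_def)
        qed (simp add: level_def init)
        thus "x t (history t d) \<in> dp_minimizers P t (level P x t d)"
          using zero_mem_dp_minimizers[OF t] by (simp add: zero[OF t])
      qed
    qed
  qed
  thus ?thesis
    using x by (simp add: robust_wp1_optimal_def zero_policies_def)
qed

end

theorem theorem4:
  fixes P :: inventory
  assumes "inventory_model P"
    and "\<And>t. t \<in> {1..horizon P} \<Longrightarrow> net_backorder_cost P t > 0"
    and "\<And>t. t \<in> {1..horizon P} \<Longrightarrow> net_holding_cost P t > 0"
    and "\<And>t. t \<in> {1..horizon P} \<Longrightarrow> demand_sd P t > 0"
    and "\<And>t. t \<in> {1..horizon P} \<Longrightarrow> demand_mean P t > 0"
    and "\<And>t. t \<in> {1..horizon P} \<Longrightarrow> demand_range P t = {0..}"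
    and "\<And>t. t \<in> {1..horizon P} \<Longrightarrow>
           (demand_sd P t)\<^sup>2 / (demand_mean P t)\<^sup>2 > net_backorder_cost P t / net_holding_cost P t"
    and "init_level P = 0"
  shows "optimal_policies P = zero_policies P \<and> strongly_time_consistent P"
proof -
  interpret scarf_regime P
    using assms(1-7) by unfold_locales
  show ?thesis
    using optimal_policies_eq zero_policy_robust assms(8)
    by (auto simp: strongly_time_consistent_def time_consistent_def)
qed

end
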